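(* Let $\mathfrak{n}\subset\mathbb{C}$ be a nonempty, closed, convex subset contained in a sector of $\mathbb{C}$, and let $T$ be an operator on a complex Hilbert space $\mathcal{H}$ with numerical range $\mathfrak{n}_T\subseteq\mathfrak{n}$. The following statements are equivalent: 1. $T$ is $\mathfrak{n}$-maximal and densely defined; 2. $R(T-\lambda I)=\mathcal{H}$ for some $\lambda\in\mathfrak{n}^c$; 3. $\mathfrak{n}^c$ is contained in the resolvent set $\rho(T)$ of $T$ (i.e., the defect index of $T$ is $0$). If these conditions are satisfied, then $T$ is closed.
   Context: $\mathcal{H}$ is a complex Hilbert space with inner product $\langle\cdot|\cdot\rangle$ and norm $\|\cdot\|$. An operator $T$ on $\mathcal{H}$ is a linear map from a linear subspace $D(T)\subseteq\mathcal{H}$ (its domain) to $\mathcal{H}$; it is not assumed bounded, closed or densely defined unless stated. $R(T)$ is its range. $T\subseteq T'$ means that $T'$ extends $T$. The numerical range of $T$ is $\mathfrak{n}_T:=\{\langle T\xi|\xi\rangle:\xi\in D(T),\|\xi\|=1\}$. The resolvent set $\rho(T)$ is the set of $\lambda\in\mathbb{C}$ such that $T-\lambda I:D(T)\to\mathcal{H}$ is a bijection with bounded inverse. For $E\subseteq\mathbb{C}$, $E^c=\mathbb{C}\setminus E$. Defect index: for $\lambda\in\mathfrak{n}^c$ (with $\mathfrak{n}$ closed and $\mathfrak{n}_T\subseteq\mathfrak{n}$) one considers the number $\dim R(T-\lambda I)^\perp$; for closable $T$ it is constant on each connected component of $\mathfrak{n}^c$, and it is called a defect index of $T$. For a nonempty,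 convex, proper subset $\mathfrak{n}$ of $\mathbb{C}$, an operator $T$ is called $\mathfrak{n}$-maximal if (1) $\mathfrak{n}_T\subseteq\mathfrak{n}$ and (2) whenever $T'$ is an operator with $T\subseteq T'$ and $\mathfrak{n}_{T'}\subseteq\mathfrak{n}$, then $T=T'$. A sector is a set $\mathcal{S}=\{\lambda\in\mathbb{C}:|\arg(\lambda-\gamma)|\le\theta\}$ with $\gamma\in\mathbb{R}$, $\theta\in[0,\frac{\pi}{2})$ (the vertex $\gamma$ is included).
   Formalization: In item 3 the gloss "the defect index of T is 0" is stated as "T is closed and its defect index is 0": without closedness it fails, e.g. for the zero operator on finitely supported sequences in ℓ², which has defect index 0 but empty resolvent set. *)

theory Defs
  imports "HOL-Analysis.Analysis"
begin

text \<open>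
  Complex Hilbert spaces. The inner product is linear in its \<^emph>\<open>first\<close> argument: this is the
  convention for which \<open>\<langle>T\<xi> | \<xi>\<rangle> - \<lambda>\<close> is the value of \<open>T - \<lambda>I\<close> at a unit vector.
\<close>

class complex_hilbert_space = banach +
  fixes scaleC :: "complex \<Rightarrow> 'a \<Rightarrow> 'a" (infixr \<open>*\<^sub>C\<close> 75)
    and cinner :: "'a \<Rightarrow> 'a \<Rightarrow> complex"
  assumes scaleC_add_right: "a *\<^sub>C (x + y) = a *\<^sub>C x + a *\<^sub>C y"
    and scaleC_add_left: "(a + b) *\<^sub>C x = a *\<^sub>C x + b *\<^sub>C x"
    and scaleC_scaleC: "a *\<^sub>C (b *\<^sub>C x) = (a * b) *\<^sub>C x"
    and scaleC_one: "1 *\<^sub>C x = x"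
    and scaleR_scaleC: "scaleR r x = complex_of_real r *\<^sub>C x"
    and cinner_add_left: "cinner (x + y) z = cinner x z + cinner y z"
    and cinner_scaleC_left: "cinner (a *\<^sub>C x) y = a * cinner x y"
    and cinner_commute: "cinner x y = cnj (cinner y x)"
    and norm_sq_eq_cinner: "complex_of_real ((norm x)\<^sup>2) = cinner x x"

global_interpretation complex_vector:
  vector_space "scaleC :: complex \<Rightarrow> 'a \<Rightarrow> 'a::complex_hilbert_space"
  by unfold_locales
    (simp_all add: scaleC_add_right scaleC_add_left scaleC_scaleC scaleC_one)

text \<open>
  An operator is a partial function \<open>T\<close> with domain \<^term>\<open>dom T\<close> and range \<^term>\<open>ran T\<close>.
  \<open>T \<subseteq>\<^sub>m T'\<close> says that \<open>T'\<close> extends \<open>T\<close>, and \<open>T = T'\<close> is equality of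
  operators, domains included.
\<close>

definition is_operator :: "('a::complex_hilbert_space \<rightharpoonup> 'a) \<Rightarrow> bool" where
  "is_operator T \<longleftrightarrow> complex_vector.subspace (dom T) \<and>
     (\<forall>x\<in>dom T. \<forall>y\<in>dom T. the (T (x + y)) = the (T x) + the (T y)) \<and>
     (\<forall>c. \<forall>x\<in>dom T. the (T (c *\<^sub>C x)) = c *\<^sub>C the (T x))"

definition densely_defined :: "('a::complex_hilbert_space \<rightharpoonup> 'a) \<Rightarrow> bool" where
  "densely_defined T \<longleftrightarrow> closure (dom T) = UNIV"

definition closed_operator :: "('a::complex_hilbert_space \<rightharpoonup> 'a) \<Rightarrow> bool" where
  "closed_operator T \<longleftrightarrow> closed (Map.graph T)"

definition numerical_range :: "('a::complex_hilbert_space \<rightharpoonup> 'a) \<Rightarrow> complex set" where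
  "numerical_range T = {cinner (the (T x)) x | x. x \<in> dom T \<and> norm x = 1}"

text \<open>The operator \<open>T - \<lambda>I\<close>, with the same domain as \<open>T\<close>.\<close>

definition op_shift :: "('a::complex_hilbert_space \<rightharpoonup> 'a) \<Rightarrow> complex \<Rightarrow> ('a \<rightharpoonup> 'a)" where
  "op_shift T l = (\<lambda>x. map_option (\<lambda>y. y - l *\<^sub>C x) (T x))"

text \<open>
  \<^const>\<open>bounded_linear\<close> refers to real scalars, but the inverse of a complex linear bijection
  is automatically complex linear, so only its boundedness is at stake.
\<close>

definition resolvent_set :: "('a::complex_hilbert_space \<rightharpoonup> 'a) \<Rightarrow> complex set" where
  "resolvent_set T = {l.
     bij_betw (\<lambda>x. the (op_shift T l x)) (dom T) UNIV \<and>
     bounded_linear (inv_into (dom T) (\<lambda>x. the (op_shift T l x)))}"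

definition orth_complement :: "'a::complex_hilbert_space set \<Rightarrow> 'a set" where
  "orth_complement A = {y. \<forall>x\<in>A. cinner x y = 0}"

text \<open>
  \<^const>\<open>complex_vector.dim\<close> is \<open>0\<close> on infinite-dimensional spaces, hence the explicit value \<open>\<infinity>\<close>.
\<close>

definition cdim :: "'a::complex_hilbert_space set \<Rightarrow> enat" where
  "cdim V = (if \<exists>B. finite B \<and> V \<subseteq> complex_vector.span B
             then enat (complex_vector.dim V) else \<infinity>)"

definition defect_number :: "('a::complex_hilbert_space \<rightharpoonup> 'a) \<Rightarrow> complex \<Rightarrow> enat" where
  "defect_number T l = cdim (orth_complement (ran (op_shift T l)))"

definition maximal_wrt :: "complex set \<Rightarrow> ('a::complex_hilbert_space \<rightharpoonup> 'a) \<Rightarrow> bool" where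
  "maximal_wrt N T \<longleftrightarrow> numerical_range T \<subseteq> N \<and>
     (\<forall>T'. is_operator T' \<and> T \<subseteq>\<^sub>m T' \<and> numerical_range T' \<subseteq> N \<longrightarrow> T = T')"

text \<open>As \<open>Arg 0 = 0\<close>, the vertex \<open>g\<close> belongs to the sector.\<close>

definition sector :: "real \<Rightarrow> real \<Rightarrow> complex set" where
  "sector g t = {l. \<bar>Arg (l - complex_of_real g)\<bar> \<le> t}"

definition is_sector :: "complex set \<Rightarrow> bool" where
  "is_sector S \<longleftrightarrow> (\<exists>g t. 0 \<le> t \<and> t < pi / 2 \<and> S = sector g t)"

end

theory Submission
  imports Defs
begin

text \<open>
  Everything rests on two facts about an operator \<open>T\<close> whose numerical range lies in the closed
  set \<open>N\<close>.

  \<^item> \<^emph>\<open>Distance to \<open>N\<close>.\<close> At a unit vector \<open>x\<close> the number \<open>\<langle>(T - \<lambda>)x|x\<rangle>\<close> is the difference of a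
    point of \<open>N\<close> and \<open>\<lambda>\<close>, so \<open>\<parallel>(T - \<lambda>)x\<parallel> \<ge> dist(\<lambda>, N) \<parallel>x\<parallel>\<close> (\<open>lower_bound\<close>). For \<open>\<lambda>\<close> outside \<open>N\<close> the
    operator \<open>T - \<lambda>\<close> is therefore injective with bounded inverse on its range, and the only
    question is whether it is onto. If it is, \<open>T\<close> is closed, \<open>\<lambda>\<close> is in the resolvent set, and
    no proper extension of \<open>T\<close> keeps its numerical range in \<open>N\<close>, since such an extension would
    again be injective after the shift. By a fixed point argument surjectivity at \<open>\<lambda>\<close> persists at all
    points closer to \<open>\<lambda>\<close> than \<open>N\<close> is; so it is a locally constant property, hence the same at all
    points of the complement of \<open>N\<close>, which is connected because \<open>N\<close> is convex and a sector of
    opening less than \<open>\<pi>\<close> contains no line (\<open>connected_compl_convex_in_cone\<close>).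

  \<^item> \<^emph>\<open>The Friedrichs construction.\<close> Let \<open>b\<close> lie one unit to the left of the vertex of the sector.
    The form \<open>\<langle>(T - b)x|y\<rangle>\<close> is coercive and bounded in its own energy norm. For every vector \<open>f\<close>
    there is thus a sequence in the domain, Cauchy in energy with limit \<open>u\<close>, that solves
    \<open>(T - b)u = f\<close> weakly (\<open>weak_solution\<close>). If \<open>T\<close> is densely defined, \<open>u \<mapsto> f + b u\<close> extends \<open>T\<close> to
    the span of the domain and \<open>u\<close>, and the values of the extended form are limits of values of
    the old one, so the numerical range stays in \<open>N\<close>. A maximal \<open>T\<close> already has \<open>u\<close> in its
    domain, which makes \<open>T - b\<close> onto (\<open>maximal_dense_imp_onto\<close>).

  The weak solutions are obtained by descent inside the domain, without completing it in the
  energy norm and without a representation theorem. Applied to the identity on a closed subspace, the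
  same argument yields the orthogonal decomposition of a Hilbert space, which is what turns trivial
  orthogonal complements into density and a vanishing defect index into surjectivity.
\<close>

section \<open>Complex inner products\<close>

lemma cinner_add_right: "cinner x (y + z) = cinner x y + cinner x z"
  for x :: "'a::complex_hilbert_space"
  by (metis cinner_add_left cinner_commute complex_cnj_add)

lemma cinner_scaleC_right: "cinner x (a *\<^sub>C y) = cnj a * cinner x y"
  for x :: "'a::complex_hilbert_space"
  by (metis cinner_commute cinner_scaleC_left complex_cnj_mult)

lemma cinner_zero_left [simp]: "cinner 0 y = 0" for y :: "'a::complex_hilbert_space"
  using cinner_scaleC_left[of 0 0 y] by simp

lemma cinner_zero_right [simp]: "cinner y 0 = 0" for y :: "'a::complex_hilbert_space"
  by (metis cinner_commute cinner_zero_left complex_cnj_zero)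

lemma cinner_minus_left: "cinner (- x) y = - cinner x y" for x :: "'a::complex_hilbert_space"
  using cinner_add_left[of x "- x" y] by (simp add: eq_neg_iff_add_eq_0 add.commute)

lemma cinner_minus_right: "cinner x (- y) = - cinner x y" for x :: "'a::complex_hilbert_space"
  using cinner_add_right[of x y "- y"] by (simp add: eq_neg_iff_add_eq_0 add.commute)

lemma cinner_diff_left: "cinner (x - y) z = cinner x z - cinner y z"
  for x :: "'a::complex_hilbert_space"
  using cinner_add_left[of x "- y" z] by (simp add: cinner_minus_left)

lemma cinner_diff_right: "cinner x (y - z) = cinner x y - cinner x z"
  for x :: "'a::complex_hilbert_space"
  using cinner_add_right[of x y "- z"] by (simp add: cinner_minus_right)

lemma cinner_self: "cinner x x = complex_of_real ((norm x)\<^sup>2)" for x :: "'a::complex_hilbert_space"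
  by (simp only: norm_sq_eq_cinner)

lemma mult_cnj_self: "z * cnj z = complex_of_real ((cmod z)\<^sup>2)"
  using complex_norm_square[of z] by simp

lemma norm_scaleC: "norm (a *\<^sub>C x) = cmod a * norm x" for x :: "'a::complex_hilbert_space"
proof -
  have "complex_of_real ((norm (a *\<^sub>C x))\<^sup>2) = (a * cnj a) * cinner x x"
    unfolding norm_sq_eq_cinner by (simp add: cinner_scaleC_left cinner_scaleC_right)
  also have "\<dots> = complex_of_real ((cmod a * norm x)\<^sup>2)"
    unfolding mult_cnj_self cinner_self by (simp add: power_mult_distrib)
  finally have "(norm (a *\<^sub>C x))\<^sup>2 = (cmod a * norm x)\<^sup>2"
    unfolding of_real_eq_iff .
  then show ?thesis
    by (simp add: power2_eq_iff_nonneg)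
qed

lemma cinner_Cauchy_Schwarz: "cmod (cinner x y) \<le> norm x * norm y"
  for x :: "'a::complex_hilbert_space"
proof (cases "y = 0")
  case False
  define b where "b = (norm y)\<^sup>2"
  have b: "b > 0" using False by (simp add: b_def)
  \<comment> \<open>a multiple of the component of \<open>x\<close> orthogonal to \<open>y\<close>\<close>
  define z where "z = complex_of_real b *\<^sub>C x - cinner x y *\<^sub>C y"
  have yx: "cinner y x = cnj (cinner x y)" by (rule cinner_commute)
  have yy: "cinner y y = of_real b" by (simp add: cinner_self b_def)
  have "cinner z z = of_real b * (of_real b * cinner x x - cinner x y * cnj (cinner x y))"
    unfolding z_def
    by (simp add: cinner_diff_left cinner_diff_right cinner_scaleC_left cinner_scaleC_right
        yx yy algebra_simps)
  also have "\<dots> = of_real (b * (b * (norm x)\<^sup>2 - (cmod (cinner x y))\<^sup>2))"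
    unfolding mult_cnj_self cinner_self[of x] by simp
  finally have "(norm z)\<^sup>2 = b * (b * (norm x)\<^sup>2 - (cmod (cinner x y))\<^sup>2)"
    unfolding cinner_self of_real_eq_iff .
  then have "0 \<le> b * (b * (norm x)\<^sup>2 - (cmod (cinner x y))\<^sup>2)"
    by (metis zero_le_power2)
  then have "(cmod (cinner x y))\<^sup>2 \<le> (norm x * norm y)\<^sup>2"
    using b by (simp add: zero_le_mult_iff b_def power_mult_distrib mult.commute)
  then show ?thesis
    by (rule power2_le_imp_le) simp
qed simp

lemma bounded_bilinear_cinner: "bounded_bilinear (cinner :: 'a::complex_hilbert_space \<Rightarrow> 'a \<Rightarrow> complex)"
proof
  show "\<exists>K. \<forall>a b. norm (cinner (a::'a) b) \<le> norm a * norm b * K"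
    using cinner_Cauchy_Schwarz by (intro exI[of _ 1]) auto
qed (simp_all add: cinner_add_left cinner_add_right scaleR_scaleC cinner_scaleC_left
    cinner_scaleC_right scaleR_conv_of_real)

lemma bounded_bilinear_scaleC: "bounded_bilinear (scaleC :: complex \<Rightarrow> 'a::complex_hilbert_space \<Rightarrow> 'a)"
proof
  show "\<exists>K. \<forall>a b. norm (a *\<^sub>C (b::'a)) \<le> norm a * norm b * K"
    by (intro exI[of _ 1]) (simp add: norm_scaleC)
qed (simp_all add: scaleC_add_left scaleC_add_right scaleR_scaleC scaleC_scaleC
    scaleR_conv_of_real mult.commute)

lemmas tendsto_cinner = bounded_bilinear.tendsto[OF bounded_bilinear_cinner]
lemmas tendsto_scaleC = bounded_bilinear.tendsto[OF bounded_bilinear_scaleC]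

section \<open>Coercive sectorial forms\<close>

text \<open>
  The weak Lax--Milgram problem for the form \<open>\<langle>A x|y\<rangle>\<close>. The constant \<open>1\<close> in the coercivity estimate
  is a normalization; \<open>K\<close> controls the imaginary part of the form by its real part.
\<close>

locale sectorial_form =
  fixes D :: "'a::complex_hilbert_space set" and A :: "'a \<Rightarrow> 'a" and K :: real
  assumes subspace: "complex_vector.subspace D"
    and add: "x \<in> D \<Longrightarrow> y \<in> D \<Longrightarrow> A (x + y) = A x + A y"
    and scale: "x \<in> D \<Longrightarrow> A (c *\<^sub>C x) = c *\<^sub>C A x"
    and coercive: "x \<in> D \<Longrightarrow> (norm x)\<^sup>2 \<le> Re (cinner (A x) x)"
    and sectorial: "x \<in> D \<Longrightarrow> cmod (cinner (A x) x) \<le> K * Re (cinner (A x) x)"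
    and K_ge_1: "1 \<le> K"
begin

definition energy :: "'a \<Rightarrow> real" where
  "energy x = Re (cinner (A x) x)"

definition energy_norm :: "'a \<Rightarrow> real" where
  "energy_norm x = sqrt (energy x)"

lemmas D_add = complex_vector.subspace_add[OF subspace]
  and D_scale = complex_vector.subspace_scale[OF subspace]
  and D_diff = complex_vector.subspace_diff[OF subspace]
  and D_zero = complex_vector.subspace_0[OF subspace]

lemma A_zero: "A 0 = 0"
  using scale[OF D_zero, of 0] by simp

lemma A_diff: "A (x - y) = A x - A y" if "x \<in> D" "y \<in> D"
proof -
  have "A x = A ((x - y) + y)" by simp
  also have "\<dots> = A (x - y) + A y" using that D_diff by (intro add)
  finally show ?thesis by simp
qed

lemma norm_le_energy_norm: "norm x \<le> energy_norm x" if "x \<in> D"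
  using coercive[OF that] by (simp add: energy_norm_def energy_def real_le_rsqrt)

lemma energy_nonneg: "0 \<le> energy x" if "x \<in> D"
  using coercive[OF that] zero_le_power2[of "norm x"] unfolding energy_def by linarith

lemma energy_norm_nonneg: "0 \<le> energy_norm x" if "x \<in> D"
  using energy_nonneg[OF that] by (simp add: energy_norm_def)

lemma energy_norm_sq: "(energy_norm x)\<^sup>2 = energy x" if "x \<in> D"
  using energy_nonneg[OF that] by (simp add: energy_norm_def)

lemma energy_norm_eq_0D: "x = 0" if "x \<in> D" "energy_norm x = 0"
  using norm_le_energy_norm[OF that(1)] that(2) by simp

lemma energy_norm_pos: "0 < energy_norm x" if "x \<in> D" "x \<noteq> 0"
  using energy_norm_nonneg[OF that(1)] energy_norm_eq_0D[OF that(1)] that(2) by linarith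

lemma energy_norm_zero: "energy_norm 0 = 0"
  by (simp add: energy_norm_def energy_def)

lemma energy_scale: "energy (c *\<^sub>C x) = (cmod c)\<^sup>2 * energy x" if "x \<in> D"
proof -
  have "cinner (A (c *\<^sub>C x)) (c *\<^sub>C x) = c * cnj c * cinner (A x) x"
    using that by (simp add: scale cinner_scaleC_left cinner_scaleC_right)
  also have "c * cnj c = of_real ((cmod c)\<^sup>2)"
    by (rule mult_cnj_self)
  finally show ?thesis
    by (simp only: energy_def Re_complex_of_real Im_complex_of_real mult_zero_left diff_zero times_complex.sel)
qed

lemma energy_norm_scale: "energy_norm (c *\<^sub>C x) = cmod c * energy_norm x" if "x \<in> D"
  using that by (simp add: energy_norm_def energy_scale real_sqrt_mult)

lemma form_expand:
  assumes "v \<in> D" "w \<in> D"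
  shows "cinner (A (v + c *\<^sub>C w)) (v + c *\<^sub>C w) =
    cinner (A v) v + cnj c * cinner (A v) w + c * cinner (A w) v + c * cnj c * cinner (A w) w"
  using assms D_scale
  by (simp add: add scale cinner_add_left cinner_add_right cinner_scaleC_left cinner_scaleC_right
      algebra_simps)

lemma energy_parallelogram:
  assumes "v \<in> D" "w \<in> D"
  shows "energy (v + w) + energy (v - w) = 2 * energy v + 2 * energy w"
  using assms
  by (simp add: energy_def add A_diff cinner_add_left cinner_add_right cinner_diff_left
      cinner_diff_right)

text \<open>
  Polarization expresses \<open>\<langle>A v|w\<rangle>\<close> by four diagonal values of the form. Each is at most \<open>K\<close> times an
  energy, and the four energies add up by the parallelogram law.
\<close>

lemma form_bound_by_energies:
  assumes "v \<in> D" "w \<in> D"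
  shows "cmod (cinner (A v) w) \<le> K * (energy v + energy w)"
proof -
  define Q where "Q c = cinner (A (v + c *\<^sub>C w)) (v + c *\<^sub>C w)" for c
  have Q: "cmod (Q c) \<le> K * Re (Q c)" for c
    unfolding Q_def using assms D_add D_scale by (intro sectorial) auto
  have Qe: "Q c = cinner (A v) v + cnj c * cinner (A v) w + c * cinner (A w) v
      + c * cnj c * cinner (A w) w" for c
    unfolding Q_def using form_expand[OF assms] .
  \<comment> \<open>polarization over the fourth roots of unity\<close>
  have "4 * cinner (A v) w = Q 1 + \<i> * Q \<i> - Q (-1) - \<i> * Q (-\<i>)"
    unfolding Qe by (simp add: algebra_simps)
  then have "cmod (4 * cinner (A v) w) \<le> cmod (Q 1) + cmod (\<i> * Q \<i>) + cmod (Q (-1)) + cmod (\<i> * Q (-\<i>))"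
    using norm_triangle_ineq4[of "Q 1 + \<i> * Q \<i> - Q (-1)" "\<i> * Q (-\<i>)"]
      norm_triangle_ineq4[of "Q 1 + \<i> * Q \<i>" "Q (-1)"] norm_triangle_ineq[of "Q 1" "\<i> * Q \<i>"]
    by simp
  also have "\<dots> \<le> K * (Re (Q 1) + Re (Q \<i>) + Re (Q (-1)) + Re (Q (-\<i>)))"
    using Q[of 1] Q[of \<i>] Q[of "-1"] Q[of "-\<i>"] by (simp add: norm_mult algebra_simps)
  also have "Re (Q 1) + Re (Q \<i>) + Re (Q (-1)) + Re (Q (-\<i>)) = 4 * (energy v + energy w)"
    unfolding Qe energy_def by simp
  finally have "4 * cmod (cinner (A v) w) \<le> K * (4 * (energy v + energy w))"
    by (simp only: norm_mult norm_numeral)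
  then show ?thesis by (simp only: mult.left_commute[of K 4])
qed

text \<open>Scaling \<open>v\<close> and \<open>w\<close> to unit energy turns the sum of energies into a product of norms.\<close>

lemma form_bound:
  assumes v: "v \<in> D" and w: "w \<in> D"
  shows "cmod (cinner (A v) w) \<le> 2 * K * energy_norm v * energy_norm w"
proof (cases "v = 0 \<or> w = 0")
  case True
  then show ?thesis by (auto simp: A_zero energy_norm_zero)
next
  case False
  define a b where "a = energy_norm v" and "b = energy_norm w"
  have pos: "a > 0" "b > 0"
    using False v w by (auto simp: a_def b_def energy_norm_pos)
  have ab: "energy v = a\<^sup>2" "energy w = b\<^sup>2"
    using v w energy_norm_sq unfolding a_def b_def by auto
  define v' w' where "v' = of_real (1 / a) *\<^sub>C v" and "w' = of_real (1 / b) *\<^sub>C w"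
  have "energy v' = 1" "energy w' = 1"
    using pos v w by (simp_all add: v'_def w'_def energy_scale ab norm_divide power_divide)
  then have "cmod (cinner (A v') w') \<le> 2 * K"
    using form_bound_by_energies[of v' w'] v w D_scale unfolding v'_def w'_def by fastforce
  moreover have "cinner (A v') w' = cinner (A v) w / of_real (a * b)"
    using v by (simp add: v'_def w'_def scale cinner_scaleC_left cinner_scaleC_right)
  ultimately have "cmod (cinner (A v) w) / (a * b) \<le> 2 * K"
    using pos by (simp add: norm_divide norm_mult)
  then show ?thesis
    using pos by (simp add: a_def b_def divide_le_eq mult.assoc)
qed

text \<open>
  A bound on an antilinear functional fails at a vector of energy norm one where the functional has
  a large \<^emph>\<open>real part\<close>: rotate the offending vector by the phase of the value.
\<close>

lemma unit_witness:
  assumes w: "w \<in> D" and gt: "\<beta> * energy_norm w < cmod (cinner h w)"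
  obtains w' where "w' \<in> D" "energy_norm w' = 1" "\<beta> < Re (cinner h w')"
proof -
  define z where "z = cinner h w"
  have "w \<noteq> 0" using gt by (auto simp: energy_norm_zero)
  then have e: "energy_norm w > 0"
    using w by (intro energy_norm_pos)
  show thesis
  proof (cases "z = 0")
    case True
    \<comment> \<open>here \<open>\<beta>\<close> is negative, and \<open>sgn z = 0\<close> is no longer a phase\<close>
    define w' where "w' = of_real (1 / energy_norm w) *\<^sub>C w"
    have "\<beta> < 0" using gt True e by (simp add: z_def mult_less_0_iff)
    then show thesis
      using that[of w'] True w e D_scale
      by (simp add: w'_def energy_norm_scale z_def cinner_scaleC_right norm_divide)
  next
    case False
    define w' where "w' = (sgn z * of_real (1 / energy_norm w)) *\<^sub>C w"
    have "cinner h w' = cnj (sgn z) * z * of_real (1 / energy_norm w)"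
      by (simp add: w'_def cinner_scaleC_right z_def)
    also have "cnj (sgn z) * z = of_real (cmod z)"
      using False complex_norm_square[of z]
      by (simp add: sgn_div_norm scaleR_conv_of_real field_simps power2_eq_square)
    finally have "Re (cinner h w') = cmod z / energy_norm w" by simp
    then have "\<beta> < Re (cinner h w')" using gt e by (simp add: z_def less_divide_eq)
    moreover have "energy_norm w' = 1"
      using w e False by (simp add: w'_def energy_norm_scale norm_mult norm_divide norm_sgn)
    moreover have "w' \<in> D" using w by (simp add: w'_def D_scale)
    ultimately show thesis using that by blast
  qed
qed

text \<open>
  The step length of the descent, chosen such that \<open>4 s (1 + C) = 1 / (2 C)\<^sup>2\<close> for the bound \<open>C = 2 K\<close>
  of the form; this is the amount of uniform convexity that the descent consumes.
\<close>

definition step_size :: real where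
  "step_size = 1 / (16 * (2 * K)\<^sup>2 * (1 + 2 * K))"

lemma step_size_pos: "0 < step_size"
  using K_ge_1 by (simp add: step_size_def)

lemma step_size_le_1: "step_size \<le> 1"
proof -
  have "1 \<le> K\<^sup>2" using K_ge_1 by (simp add: one_le_power)
  then have "1 \<le> 16 * (2 * K)\<^sup>2" by (simp add: power_mult_distrib)
  then have "1 * 1 \<le> (16 * (2 * K)\<^sup>2) * (1 + 2 * K)"
    using K_ge_1 by (intro mult_mono) auto
  then show ?thesis using K_ge_1 by (simp add: step_size_def divide_le_eq)
qed

text \<open>
  One step of the descent. Let \<open>r\<close> bound the dual energy norm of \<open>\<langle>g|\<cdot>\<rangle>\<close>. If the bound is far from
  optimal, no step is needed; otherwise let \<open>v\<close> be a unit vector that almost attains it. Subtracting \<open>r s A v\<close> from \<open>g\<close> lowers the dual norm by a fixed factor. For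
  suppose a unit vector \<open>w\<close> still gave a large value. As the step is short, \<open>w\<close> also almost attains
  the norm of \<open>\<langle>g|\<cdot>\<rangle>\<close>; then \<open>v + w\<close> has norm nearly two, and the parallelogram law forces \<open>w\<close>
  to be close to \<open>v\<close>. But near \<open>v\<close> the real part of \<open>\<langle>A v|w\<rangle>\<close> is at least one half by coercivity, so
  the step has lowered the value at \<open>w\<close>. This takes the place of the Riesz representation of
  \<open>\<langle>g|\<cdot>\<rangle>\<close> in \<open>D\<close>, which would require completeness in the energy norm.
\<close>

lemma residual_decrease:
  assumes res: "\<And>w. w \<in> D \<Longrightarrow> cmod (cinner g w) \<le> r * energy_norm w" and r: "0 \<le> r"
  shows "\<exists>v\<in>D. \<forall>w\<in>D. cmod (cinner (g - A v) w) \<le> (1 - step_size / 2) * r * energy_norm w"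
proof (cases "\<forall>w\<in>D. cmod (cinner g w) \<le> (1 - step_size / 2) * r * energy_norm w")
  case True
  then show ?thesis using D_zero by (intro bexI[of _ 0]) (auto simp: A_zero)
next
  case False
  define s C where "s = step_size" and "C = 2 * K"
  have C: "C > 0" and s: "0 < s" using K_ge_1 step_size_pos by (simp_all add: C_def s_def)
  have sC: "s * (1 + C) = 1 / (16 * C\<^sup>2)"
    using C by (simp add: s_def C_def step_size_def)
  obtain v0 where "v0 \<in> D" "(1 - s / 2) * r * energy_norm v0 < cmod (cinner g v0)"
    using False unfolding s_def by (auto simp: not_le)
  then obtain v where v: "v \<in> D" "energy_norm v = 1" "(1 - s / 2) * r < Re (cinner g v)"
    by (rule unit_witness)
  show ?thesis
  proof (intro bexI[of _ "of_real (r * s) *\<^sub>C v"] ballI D_scale v(1), rule ccontr)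
    fix w0 assume "w0 \<in> D" and "\<not> cmod (cinner (g - A (of_real (r * s) *\<^sub>C v)) w0)
      \<le> (1 - step_size / 2) * r * energy_norm w0"
    then have "w0 \<in> D"
      "(1 - s / 2) * r * energy_norm w0 < cmod (cinner (g - A (of_real (r * s) *\<^sub>C v)) w0)"
      by (simp_all add: s_def not_le)
    then obtain w where w: "w \<in> D" "energy_norm w = 1"
      "(1 - s / 2) * r < Re (cinner (g - A (of_real (r * s) *\<^sub>C v)) w)"
      by (rule unit_witness)
    define \<alpha> where "\<alpha> = Re (cinner (A v) w)"
    have gw: "(1 - s / 2) * r + r * s * \<alpha> < Re (cinner g w)"
      using w(3) v(1) by (simp add: scale cinner_diff_left cinner_scaleC_left \<alpha>_def)
    have r0: "r > 0"
    proof (rule ccontr)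
      assume "\<not> 0 < r"
      then have "r = 0" using r by simp
      then show False using res[OF v(1)] v(3) complex_Re_le_cmod[of "cinner g v"] by simp
    qed
    have "\<bar>\<alpha>\<bar> \<le> C"
      using form_bound[OF v(1) w(1)] v(2) w(2) abs_Re_le_cmod[of "cinner (A v) w"]
      by (simp add: \<alpha>_def C_def)
    then have "r * s * (- C) \<le> r * s * \<alpha>"
      using r0 s by (intro mult_left_mono) auto
    then have "r * (2 - s * (1 + C)) < Re (cinner g (v + w))"
      using v(3) gw by (simp add: cinner_add_right algebra_simps)
    also have "\<dots> \<le> r * energy_norm (v + w)"
      using res[OF D_add[OF v(1) w(1)]] complex_Re_le_cmod[of "cinner g (v + w)"] by linarith
    finally have sum: "2 - s * (1 + C) < energy_norm (v + w)" using r0 by simp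
    \<comment> \<open>two unit vectors with a long sum are close to each other\<close>
    have "s * (1 + C) \<le> 2"
    proof -
      have "1 \<le> C\<^sup>2" using K_ge_1 unfolding C_def by (intro one_le_power) simp
      then show ?thesis unfolding sC using C by (simp add: divide_le_eq)
    qed
    then have "(2 - s * (1 + C))\<^sup>2 \<le> (energy_norm (v + w))\<^sup>2"
      using sum by (intro power_mono) auto
    moreover have "(energy_norm (v + w))\<^sup>2 + (energy_norm (v - w))\<^sup>2 = 4"
      using energy_parallelogram[OF v(1) w(1)] energy_norm_sq[OF v(1)] energy_norm_sq[OF w(1)]
        v w D_add D_diff
      by (simp add: energy_norm_sq)
    moreover have "(2 - s * (1 + C))\<^sup>2 \<ge> 4 - 4 * (s * (1 + C))"
      by (simp add: power2_diff)
    ultimately have "(energy_norm (v - w))\<^sup>2 \<le> 4 * (s * (1 + C))" by linarith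
    also have "\<dots> = (1 / (2 * C))\<^sup>2" unfolding sC by (simp add: power_divide power_mult_distrib)
    finally have close: "energy_norm (v - w) \<le> 1 / (2 * C)"
      by (rule power2_le_imp_le) (use C in simp)
    have "Re (cinner (A v) (v - w)) \<le> C * energy_norm (v - w)"
      using form_bound[OF v(1) D_diff[OF v(1) w(1)]] v(2)
        complex_Re_le_cmod[of "cinner (A v) (v - w)"] by (simp add: C_def)
    also have "\<dots> \<le> C * (1 / (2 * C))" using close C by (intro mult_left_mono) auto
    also have "\<dots> = 1 / 2" using C by simp
    finally have "1 / 2 \<le> \<alpha>"
      using energy_norm_sq[OF v(1)] v(2) by (simp add: \<alpha>_def energy_def cinner_diff_right)
    then have "r * s * (1 / 2) \<le> r * s * \<alpha>" using r0 s by (intro mult_left_mono) auto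
    then have "r < Re (cinner g w)" using gw by (simp add: algebra_simps)
    then show False
      using res[OF w(1)] w(2) complex_Re_le_cmod[of "cinner g w"] by simp
  qed
qed

lemma approximate_solution:
  "\<exists>x\<in>D. \<forall>w\<in>D. cmod (cinner (f - A x) w) \<le> (1 - step_size / 2) ^ n * norm f * energy_norm w"
proof (induction n)
  case 0
  have "cmod (cinner f w) \<le> norm f * energy_norm w" if "w \<in> D" for w
    using cinner_Cauchy_Schwarz[of f w] norm_le_energy_norm[OF that]
    by (meson mult_left_mono norm_ge_zero order_trans)
  then show ?case using D_zero by (intro bexI[of _ 0]) (auto simp: A_zero)
next
  case (Suc n)
  then obtain x where x: "x \<in> D"
    "\<And>w. w \<in> D \<Longrightarrow> cmod (cinner (f - A x) w) \<le> (1 - step_size / 2) ^ n * norm f * energy_norm w"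
    by blast
  have "0 \<le> (1 - step_size / 2) ^ n * norm f" using step_size_le_1 by simp
  from residual_decrease[OF x(2) this] obtain v where v: "v \<in> D"
    "\<And>w. w \<in> D \<Longrightarrow> cmod (cinner (f - A x - A v) w)
      \<le> (1 - step_size / 2) * ((1 - step_size / 2) ^ n * norm f) * energy_norm w" by auto
  then show ?case
    using x(1) by (intro bexI[of _ "x + v"] ballI) (auto simp: add D_add diff_diff_eq mult.assoc)
qed

text \<open>
  Iterating the descent gives vectors whose residuals tend to zero in the dual energy norm.
  Coercivity, applied to differences, makes the sequence Cauchy; applied to the
  sequence itself, it bounds the energies. The residuals being small \<^emph>\<open>uniformly\<close> on bounded energy,
  the form may be evaluated along the sequence in both arguments, which yields the last limit.
\<close>

theorem weak_solution:
  obtains X u where "\<And>n. X n \<in> D" "X \<longlonglongrightarrow> u"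
    "\<And>w. w \<in> D \<Longrightarrow> (\<lambda>n. cinner (A (X n)) w) \<longlonglongrightarrow> cinner f w"
    "(\<lambda>n. cinner (A (X n)) (X n)) \<longlonglongrightarrow> cinner f u"
proof -
  define r where "r n = (1 - step_size / 2) ^ n * norm f" for n
  obtain X where X: "\<And>n. X n \<in> D"
    "\<And>n w. w \<in> D \<Longrightarrow> cmod (cinner (f - A (X n)) w) \<le> r n * energy_norm w"
    using approximate_solution[of f] unfolding r_def by metis
  have r0: "0 \<le> r n" for n using step_size_le_1 by (simp add: r_def)
  have rf: "r n \<le> norm f" for n
    using step_size_le_1 step_size_pos by (simp add: r_def mult_left_le_one_le power_le_one)
  have "(\<lambda>n. (1 - step_size / 2) ^ n) \<longlonglongrightarrow> 0"
    using step_size_le_1 step_size_pos by (intro LIMSEQ_power_zero) auto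
  then have rlim: "r \<longlonglongrightarrow> 0" unfolding r_def by (simp add: tendsto_mult_left_zero)
  have dist: "norm (X m - X n) \<le> r m + r n" for m n
  proof -
    define d where "d = X m - X n"
    have d: "d \<in> D" using X D_diff by (simp add: d_def)
    have "energy_norm d * energy_norm d = Re (cinner (A d) d)"
      using energy_norm_sq[OF d] by (simp add: power2_eq_square energy_def)
    also have "A d = (f - A (X n)) - (f - A (X m))" by (simp add: d_def A_diff X)
    also have "Re (cinner \<dots> d) \<le> cmod (cinner (f - A (X n)) d) + cmod (cinner (f - A (X m)) d)"
      unfolding cinner_diff_left[of "f - A (X n)"]
      by (rule order_trans[OF complex_Re_le_cmod norm_triangle_ineq4])
    also have "\<dots> \<le> (r m + r n) * energy_norm d"
      using X(2)[OF d, of n] X(2)[OF d, of m] by (simp add: distrib_right)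
    finally have "energy_norm d \<le> r m + r n"
      using energy_norm_nonneg[OF d] r0[of m] r0[of n]
      by (cases "energy_norm d = 0") auto
    then show ?thesis using norm_le_energy_norm[OF d] by (simp add: d_def)
  qed
  have "Cauchy X"
  proof (rule CauchyI)
    fix e :: real assume "e > 0"
    then have "eventually (\<lambda>n. r n < e / 2) sequentially"
      using rlim by (intro order_tendstoD) auto
    then obtain M where M: "\<And>n. n \<ge> M \<Longrightarrow> r n < e / 2" by (auto simp: eventually_sequentially)
    have "norm (X m - X n) < e" if "m \<ge> M" "n \<ge> M" for m n
      using dist[of m n] M[OF that(1)] M[OF that(2)] by linarith
    then show "\<exists>M. \<forall>m\<ge>M. \<forall>n\<ge>M. norm (X m - X n) < e" by blast
  qed
  then obtain u where u: "X \<longlonglongrightarrow> u" using Cauchy_convergent_iff convergent_def by blast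
  have lim: "(\<lambda>n. cinner (A (X n)) w) \<longlonglongrightarrow> cinner f w" if "w \<in> D" for w
  proof -
    have "(\<lambda>n. cinner f w - cinner (A (X n)) w) \<longlonglongrightarrow> 0"
    proof (rule Lim_null_comparison)
      show "\<forall>\<^sub>F n in sequentially. norm (cinner f w - cinner (A (X n)) w) \<le> r n * energy_norm w"
        using X(2)[OF that] by (simp add: cinner_diff_left)
      show "(\<lambda>n. r n * energy_norm w) \<longlonglongrightarrow> 0" using rlim by (rule tendsto_mult_left_zero)
    qed
    from tendsto_diff[OF tendsto_const[of "cinner f w"] this] show ?thesis by simp
  qed
  have bd: "energy_norm (X n) \<le> 2 * norm f" for n
  proof -
    have "energy_norm (X n) * energy_norm (X n) = Re (cinner (A (X n)) (X n))"
      using energy_norm_sq[OF X(1)] by (simp add: power2_eq_square energy_def)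
    also have "\<dots> = Re (cinner f (X n) - cinner (f - A (X n)) (X n))"
      by (simp add: cinner_diff_left)
    also have "\<dots> \<le> cmod (cinner f (X n)) + cmod (cinner (f - A (X n)) (X n))"
      by (rule order_trans[OF complex_Re_le_cmod norm_triangle_ineq4])
    also have "\<dots> \<le> norm f * energy_norm (X n) + norm f * energy_norm (X n)"
    proof (rule add_mono)
      show "cmod (cinner f (X n)) \<le> norm f * energy_norm (X n)"
        using cinner_Cauchy_Schwarz[of f "X n"] norm_le_energy_norm[OF X(1)[of n]]
        by (meson mult_left_mono norm_ge_zero order_trans)
      show "cmod (cinner (f - A (X n)) (X n)) \<le> norm f * energy_norm (X n)"
        using X(2)[OF X(1)[of n], of n] mult_right_mono[OF rf[of n] energy_norm_nonneg[OF X(1)[of n]]]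
        by linarith
    qed
    finally have "energy_norm (X n) * energy_norm (X n) \<le> (2 * norm f) * energy_norm (X n)"
      by simp
    then show ?thesis
      using energy_norm_nonneg[OF X(1)[of n]] by (cases "energy_norm (X n) = 0") auto
  qed
  have "(\<lambda>n. cinner f (X n) - cinner (A (X n)) (X n)) \<longlonglongrightarrow> 0"
  proof (rule Lim_null_comparison)
    have "norm (cinner f (X n) - cinner (A (X n)) (X n)) \<le> r n * (2 * norm f)" for n
      using X(2)[OF X(1)[of n], of n] mult_left_mono[OF bd[of n] r0[of n]]
      by (simp add: cinner_diff_left)
    then show "\<forall>\<^sub>F n in sequentially.
        norm (cinner f (X n) - cinner (A (X n)) (X n)) \<le> r n * (2 * norm f)" by simp
    show "(\<lambda>n. r n * (2 * norm f)) \<longlonglongrightarrow> 0" using rlim by (rule tendsto_mult_left_zero)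
  qed
  from tendsto_diff[OF tendsto_cinner[OF tendsto_const[of f] u] this]
  have "(\<lambda>n. cinner (A (X n)) (X n)) \<longlonglongrightarrow> cinner f u" by simp
  with X(1) u lim show thesis by (rule that)
qed

end

section \<open>Orthogonality and density\<close>

text \<open>
  For \<open>A\<close> the identity the energy norm is the norm, and the weak solution for the right-hand side
  \<open>f\<close> is the orthogonal projection of \<open>f\<close>.
\<close>

lemma closed_subspace_eq_UNIV:
  fixes R :: "'a::complex_hilbert_space set"
  assumes "complex_vector.subspace R" "closed R" "orth_complement R \<subseteq> {0}"
  shows "R = UNIV"
proof -
  interpret sectorial_form R "\<lambda>x. x" 1
    by unfold_locales (use assms(1) in \<open>auto simp: cinner_self norm_power\<close>)
  have "f \<in> R" for f
  proof -
    obtain X u where X: "\<And>n. X n \<in> R" "X \<longlonglongrightarrow> u"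
      "\<And>w. w \<in> R \<Longrightarrow> (\<lambda>n. cinner (X n) w) \<longlonglongrightarrow> cinner f w"
      using weak_solution[of f] by metis
    have u: "u \<in> R" using closed_sequentially[OF assms(2)] X(1,2) by blast
    have "cinner w (f - u) = 0" if "w \<in> R" for w
    proof -
      have "cinner f w = cinner u w"
        using X(3)[OF that] tendsto_cinner[OF X(2) tendsto_const] LIMSEQ_unique by blast
      then show ?thesis by (metis cinner_commute cinner_diff_right eq_iff_diff_eq_0)
    qed
    then have "f - u \<in> orth_complement R" by (simp add: orth_complement_def)
    then show ?thesis using assms(3) u by auto
  qed
  then show ?thesis by auto
qed

lemma subspace_closure:
  fixes D :: "'a::complex_hilbert_space set"
  assumes "complex_vector.subspace D"
  shows "complex_vector.subspace (closure D)"
  unfolding complex_vector.subspace_def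
proof (intro conjI ballI allI)
  show "0 \<in> closure D"
    using complex_vector.subspace_0[OF assms] closure_subset by blast
next
  fix x y assume "x \<in> closure D" "y \<in> closure D"
  then obtain X Y where XY: "\<And>n. X n \<in> D" "X \<longlonglongrightarrow> x" "\<And>n. Y n \<in> D" "Y \<longlonglongrightarrow> y"
    by (auto simp: closure_sequential)
  have "\<And>n. X n + Y n \<in> D" using XY complex_vector.subspace_add[OF assms] by blast
  then show "x + y \<in> closure D"
    using tendsto_add[OF XY(2,4)]
    by (auto simp: closure_sequential intro!: exI[of _ "\<lambda>n. X n + Y n"])
next
  fix c x assume "x \<in> closure D"
  then obtain X where X: "\<And>n. X n \<in> D" "X \<longlonglongrightarrow> x" by (auto simp: closure_sequential)
  have "\<And>n. c *\<^sub>C X n \<in> D" using X complex_vector.subspace_scale[OF assms] by blast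
  then show "c *\<^sub>C x \<in> closure D"
    using tendsto_scaleC[OF tendsto_const X(2), of c]
    by (auto simp: closure_sequential intro!: exI[of _ "\<lambda>n. c *\<^sub>C X n"])
qed

lemma orth_complement_closure:
  "orth_complement (closure D) = orth_complement D" for D :: "'a::complex_hilbert_space set"
proof
  show "orth_complement (closure D) \<subseteq> orth_complement D"
    using closure_subset by (auto simp: orth_complement_def)
  show "orth_complement D \<subseteq> orth_complement (closure D)"
  proof
    fix y assume y: "y \<in> orth_complement D"
    have "cinner x y = 0" if "x \<in> closure D" for x
    proof -
      obtain X where X: "\<And>n. X n \<in> D" "X \<longlonglongrightarrow> x"
        using \<open>x \<in> closure D\<close> unfolding closure_sequential by blast
      have "(\<lambda>n. cinner (X n) y) \<longlonglongrightarrow> cinner x y" by (rule tendsto_cinner[OF X(2) tendsto_const])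
      moreover have "cinner (X n) y = 0" for n using X y by (simp add: orth_complement_def)
      ultimately show ?thesis by (simp add: LIMSEQ_const_iff)
    qed
    then show "y \<in> orth_complement (closure D)" by (simp add: orth_complement_def)
  qed
qed

lemma dense_subspace_iff:
  fixes D :: "'a::complex_hilbert_space set"
  assumes "complex_vector.subspace D"
  shows "closure D = UNIV \<longleftrightarrow> orth_complement D \<subseteq> {0}"
proof
  assume "closure D = UNIV"
  then have "orth_complement D = orth_complement UNIV"
    by (metis orth_complement_closure)
  moreover have "y = 0" if "y \<in> orth_complement UNIV" for y :: 'a
  proof -
    have "cinner y y = 0" using that by (simp add: orth_complement_def)
    then show ?thesis by (simp add: cinner_self)
  qed
  ultimately show "orth_complement D \<subseteq> {0}" by auto
next
  assume "orth_complement D \<subseteq> {0}"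
  then show "closure D = UNIV"
    using closed_subspace_eq_UNIV[OF subspace_closure[OF assms]] orth_complement_closure[of D] by simp
qed

lemma cdim_eq_0_iff:
  fixes V :: "'a::complex_hilbert_space set"
  shows "cdim V = 0 \<longleftrightarrow> V \<subseteq> {0}"
proof
  assume c: "cdim V = 0"
  then obtain B where B: "finite B" "V \<subseteq> complex_vector.span B" "complex_vector.dim V = 0"
    by (auto simp: cdim_def zero_enat_def split: if_splits)
  obtain B' where B': "B' \<subseteq> V" "complex_vector.independent B'" "V \<subseteq> complex_vector.span B'"
    "card B' = complex_vector.dim V" using complex_vector.basis_exists by blast
  have "finite B'" using complex_vector.independent_span_bound[OF B(1) B'(2)] B'(1) B(2) by blast
  then have "B' = {}" using B'(4) B(3) by simp
  then show "V \<subseteq> {0}" using B'(3) by simp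
next
  assume "V \<subseteq> {0}"
  moreover have "complex_vector.dim V = 0"
    using complex_vector.dim_le_card[of V "{}"] calculation by simp
  ultimately show "cdim V = 0"
    by (auto simp: cdim_def zero_enat_def intro!: exI[of _ "{}"])
qed

text \<open>
  The reason why a weak extension of an operator is again an operator. If \<open>0\<close> were related
  to \<open>g\<close>, then \<open>y\<close> could be replaced by \<open>y + c g\<close> for every scalar \<open>c\<close> in each pair \<open>(x, y)\<close>; the real
  part of \<open>\<langle>y|x\<rangle> + c \<langle>g|x\<rangle>\<close> stays nonnegative for all \<open>c\<close> only if \<open>g\<close> is orthogonal to \<open>x\<close>.
\<close>

lemma accretive_relation_single_valued:
  fixes G :: "('a::complex_hilbert_space \<times> 'a) set"
  assumes add: "\<And>z q z' q'. (z, q) \<in> G \<Longrightarrow> (z', q') \<in> G \<Longrightarrow> (z + z', q + q') \<in> G"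
    and scale: "\<And>c z q. (z, q) \<in> G \<Longrightarrow> (c *\<^sub>C z, c *\<^sub>C q) \<in> G"
    and accretive: "\<And>z q. (z, q) \<in> G \<Longrightarrow> 0 \<le> Re (cinner q z)"
    and dense: "orth_complement (Domain G) \<subseteq> {0}"
    and zq: "(z, q) \<in> G" and zq': "(z, q') \<in> G"
  shows "q = q'"
proof -
  define g where "g = q - q'"
  have g: "(0, g) \<in> G"
    using add[OF zq scale[OF zq', of "-1"]] by (simp add: g_def)
  have "cinner x g = 0" if "x \<in> Domain G" for x
  proof (rule ccontr)
    assume "cinner x g \<noteq> 0"
    then have gx: "0 < (cmod (cinner g x))\<^sup>2"
      by (metis cinner_commute complex_cnj_zero norm_eq_zero zero_less_power2)
    obtain y where y: "(x, y) \<in> G" using \<open>x \<in> Domain G\<close> by blast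
    \<comment> \<open>chosen to make the real part of the form equal to \<open>-1\<close>\<close>
    define t where "t = (Re (cinner y x) + 1) / (cmod (cinner g x))\<^sup>2"
    have "(x, y + (- of_real t * cnj (cinner g x)) *\<^sub>C g) \<in> G"
      using add[OF y scale[OF g, of "- of_real t * cnj (cinner g x)"]] by simp
    from accretive[OF this] have "0 \<le> Re (cinner y x - of_real t * (cinner g x * cnj (cinner g x)))"
      unfolding cinner_add_left cinner_scaleC_left by (simp add: algebra_simps)
    also have "\<dots> = Re (cinner y x) - t * (cmod (cinner g x))\<^sup>2"
      unfolding mult_cnj_self by simp
    also have "\<dots> = -1" using gx by (simp add: t_def)
    finally show False by simp
  qed
  then have "g \<in> orth_complement (Domain G)" by (simp add: orth_complement_def)
  then show ?thesis using dense by (auto simp: g_def)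
qed

section \<open>Operators with numerical range in a closed set\<close>

locale operator_in_range =
  fixes T :: "'a::complex_hilbert_space \<rightharpoonup> 'a" and N :: "complex set"
  assumes operator: "is_operator T" and range: "numerical_range T \<subseteq> N"
    and closed_N: "closed N" and N_nonempty: "N \<noteq> {}"
begin

definition shift :: "complex \<Rightarrow> 'a \<Rightarrow> 'a" where
  "shift l x = the (T x) - l *\<^sub>C x"

definition onto :: "complex \<Rightarrow> bool" where
  "onto l \<longleftrightarrow> shift l ` dom T = UNIV"

lemma the_op_shift: "the (op_shift T l x) = shift l x" if "x \<in> dom T"
  using that by (auto simp: op_shift_def shift_def)

lemma ran_op_shift: "ran (op_shift T l) = shift l ` dom T"
  by (auto simp: ran_def op_shift_def shift_def image_def dom_def) force

lemma subspace_dom: "complex_vector.subspace (dom T)"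
  using operator by (simp add: is_operator_def)

lemmas dom_add = complex_vector.subspace_add[OF subspace_dom]
  and dom_scale = complex_vector.subspace_scale[OF subspace_dom]
  and dom_diff = complex_vector.subspace_diff[OF subspace_dom]

lemma shift_add: "x \<in> dom T \<Longrightarrow> y \<in> dom T \<Longrightarrow> shift l (x + y) = shift l x + shift l y"
  using operator by (simp add: is_operator_def shift_def scaleC_add_right)

lemma shift_scale: "x \<in> dom T \<Longrightarrow> shift l (c *\<^sub>C x) = c *\<^sub>C shift l x"
  using operator
  by (simp add: is_operator_def shift_def complex_vector.scale_right_diff_distrib mult.commute)

lemma shift_diff: "shift l (x - y) = shift l x - shift l y" if "x \<in> dom T" "y \<in> dom T"
proof -
  have "shift l x = shift l ((x - y) + y)" by simp
  also have "\<dots> = shift l (x - y) + shift l y" using that dom_diff by (intro shift_add)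
  finally show ?thesis by simp
qed

lemma subspace_range_shift: "complex_vector.subspace (shift l ` dom T)"
proof -
  have 0: "0 \<in> dom T" by (rule complex_vector.subspace_0[OF subspace_dom])
  have "0 \<in> shift l ` dom T" using shift_scale[OF 0, of l 0] 0 by (intro image_eqI[of _ _ 0]) auto
  moreover have "shift l x + shift l y \<in> shift l ` dom T" if "x \<in> dom T" "y \<in> dom T" for x y
    using that dom_add by (intro image_eqI[of _ _ "x + y"]) (simp_all add: shift_add)
  moreover have "c *\<^sub>C shift l x \<in> shift l ` dom T" if "x \<in> dom T" for c x
    using that dom_scale by (intro image_eqI[of _ _ "c *\<^sub>C x"]) (simp_all add: shift_scale)
  ultimately show ?thesis unfolding complex_vector.subspace_def by blast
qed

text \<open>
  The numerical range only speaks of unit vectors; homogeneity extends it to all of the domain. At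
  \<open>x = 0\<close> any point of \<open>N\<close> will do.
\<close>

lemma form_value:
  assumes x: "x \<in> dom T"
  obtains n where "n \<in> N" "\<And>l. cinner (shift l x) x = of_real ((norm x)\<^sup>2) * (n - l)"
proof (cases "x = 0")
  case True
  then show ?thesis using N_nonempty that by auto
next
  case False
  define e where "e = of_real (1 / norm x) *\<^sub>C x"
  define n where "n = cinner (the (T e)) e"
  have e: "e \<in> dom T" "norm e = 1"
    using x dom_scale False by (simp_all add: e_def norm_scaleC norm_divide)
  have "n \<in> N" using e range by (auto simp: numerical_range_def n_def)
  moreover have "cinner (shift l x) x = of_real ((norm x)\<^sup>2) * (n - l)" for l
  proof -
    have "x = of_real (norm x) *\<^sub>C e" using False by (simp add: e_def scaleC_scaleC)
    then have "cinner (shift l x) x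
        = cinner (of_real (norm x) *\<^sub>C shift l e) (of_real (norm x) *\<^sub>C e)"
      using shift_scale[OF e(1)] by metis
    also have "\<dots> = of_real ((norm x)\<^sup>2) * cinner (shift l e) e"
      by (simp add: cinner_scaleC_left cinner_scaleC_right power2_eq_square)
    also have "cinner (shift l e) e = n - l"
      using e by (simp add: shift_def n_def cinner_diff_left cinner_scaleC_left cinner_self)
    finally show ?thesis .
  qed
  ultimately show ?thesis by (rule that)
qed

lemma lower_bound: "infdist l N * norm x \<le> norm (shift l x)" if "x \<in> dom T"
proof (cases "x = 0")
  case False
  obtain n where n: "n \<in> N" "cinner (shift l x) x = of_real ((norm x)\<^sup>2) * (n - l)"
    using form_value[OF \<open>x \<in> dom T\<close>] by metis
  have "infdist l N * norm x * norm x \<le> cmod (n - l) * norm x * norm x"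
    using infdist_le[OF n(1), of l] by (intro mult_right_mono) (auto simp: dist_norm norm_minus_commute)
  also have "\<dots> = cmod (cinner (shift l x) x)"
    using n(2) by (simp add: norm_mult power2_eq_square norm_power)
  also have "\<dots> \<le> norm (shift l x) * norm x" by (rule cinner_Cauchy_Schwarz)
  finally show ?thesis using False by simp
qed simp

lemma infdist_pos: "0 < infdist l N" if "l \<notin> N"
  using that closed_N N_nonempty by (simp add: infdist_pos_not_in_closed)

lemma inj_shift: "inj_on (shift l) (dom T)" if "l \<notin> N"
proof (rule inj_onI)
  fix x y assume xy: "x \<in> dom T" "y \<in> dom T" "shift l x = shift l y"
  then have "infdist l N * norm (x - y) \<le> 0"
    using lower_bound[OF dom_diff[OF xy(1,2)], of l] by (simp add: shift_diff)
  then show "x = y" using infdist_pos[OF that] by (simp add: mult_le_0_iff)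
qed

text \<open>Meaningful only where \<open>T - l\<close> is bijective, as it is in the context below.\<close>

definition resolvent :: "complex \<Rightarrow> 'a \<Rightarrow> 'a" where
  "resolvent l = inv_into (dom T) (shift l)"

context
  fixes l assumes l: "l \<notin> N" and onto_l: "onto l"
begin

lemma resolvent_dom: "resolvent l y \<in> dom T"
  using onto_l by (simp add: resolvent_def onto_def inv_into_into)

lemma shift_resolvent: "shift l (resolvent l y) = y"
  using onto_l by (simp add: resolvent_def onto_def f_inv_into_f)

lemma resolvent_shift: "x \<in> dom T \<Longrightarrow> resolvent l (shift l x) = x"
  using inj_shift[OF l] by (simp add: resolvent_def)

lemma norm_resolvent_diff:
  "norm (resolvent l y - resolvent l z) \<le> norm (y - z) / infdist l N"
  using lower_bound[OF dom_diff[OF resolvent_dom[of y] resolvent_dom[of z]], of l] infdist_pos[OF l]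
  by (simp add: shift_diff resolvent_dom shift_resolvent field_simps)

lemma bounded_linear_resolvent: "bounded_linear (resolvent l)"
proof
  fix x y r
  have "shift l (resolvent l x + resolvent l y) = x + y"
    by (simp add: shift_add resolvent_dom shift_resolvent)
  then show "resolvent l (x + y) = resolvent l x + resolvent l y"
    using resolvent_shift[OF dom_add[OF resolvent_dom[of x] resolvent_dom[of y]]] by simp
  have "shift l (of_real r *\<^sub>C resolvent l x) = of_real r *\<^sub>C x"
    by (simp add: shift_scale resolvent_dom shift_resolvent)
  then show "resolvent l (r *\<^sub>R x) = r *\<^sub>R resolvent l x"
    using resolvent_shift[OF dom_scale[OF resolvent_dom[of x], of "of_real r"]]
    by (simp add: scaleR_scaleC)
next
  have "resolvent l 0 = 0"
    using resolvent_shift[OF complex_vector.subspace_0[OF subspace_dom]]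
      shift_scale[OF complex_vector.subspace_0[OF subspace_dom], of l 0] by simp
  then have "norm (resolvent l x) \<le> norm x * (1 / infdist l N)" for x
    using norm_resolvent_diff[of x 0] by simp
  then show "\<exists>K. \<forall>x. norm (resolvent l x) \<le> norm x * K" by blast
qed

lemma onto_imp_resolvent_set: "l \<in> resolvent_set T"
proof -
  have "bij_betw (\<lambda>x. the (op_shift T l x)) (dom T) UNIV"
    using inj_shift[OF l] onto_l the_op_shift
    by (simp add: bij_betw_def onto_def cong: inj_on_cong image_cong_simp)
  moreover have "inv_into (dom T) (\<lambda>x. the (op_shift T l x)) = resolvent l"
    by (simp add: fun_eq_iff resolvent_def inv_into_def the_op_shift cong: conj_cong)
  ultimately show ?thesis
    using bounded_linear_resolvent by (simp add: resolvent_set_def)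
qed

lemma onto_imp_closed: "closed_operator T"
  unfolding closed_operator_def closed_sequential_limits
proof (intro allI impI, elim conjE)
  fix P q assume P: "\<forall>n. P n \<in> Map.graph T" and lim: "P \<longlonglongrightarrow> q"
  define X Y where "X n = fst (P n)" and "Y n = snd (P n)" for n
  obtain x y where q: "q = (x, y)" by (cases q)
  have XY: "T (X n) = Some (Y n)" for n
    using P unfolding X_def Y_def by (intro in_graphD) simp
  have X: "X \<longlonglongrightarrow> x" and Y: "Y \<longlonglongrightarrow> y"
    using tendsto_fst[OF lim] tendsto_snd[OF lim] unfolding X_def Y_def q by simp_all
  have "resolvent l (Y n - l *\<^sub>C X n) = X n" for n
  proof -
    have "X n \<in> dom T" "shift l (X n) = Y n - l *\<^sub>C X n" using XY[of n] by (auto simp: shift_def)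
    then show ?thesis using resolvent_shift by metis
  qed
  moreover have "(\<lambda>n. resolvent l (Y n - l *\<^sub>C X n)) \<longlonglongrightarrow> resolvent l (y - l *\<^sub>C x)"
    by (intro bounded_linear.tendsto[OF bounded_linear_resolvent] tendsto_diff tendsto_scaleC
        tendsto_const X Y)
  ultimately have x: "x = resolvent l (y - l *\<^sub>C x)"
    by (intro LIMSEQ_unique[OF X]) (simp only:)
  then have "x \<in> dom T" using resolvent_dom[of "y - l *\<^sub>C x"] by metis
  moreover have "shift l x = y - l *\<^sub>C x" using arg_cong[OF x, of "shift l"] by (simp only: shift_resolvent)
  ultimately show "q \<in> Map.graph T" by (auto simp: q shift_def Map.graph_def)
qed

text \<open>
  Given \<open>x\<close> in the domain of an extension \<open>T'\<close>, surjectivity of \<open>T - l\<close> finds \<open>y\<close> in the domain of \<open>T\<close> with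
  \<open>(T' - l)x = (T' - l)y\<close>. But \<open>T' - l\<close> is injective, the numerical range of \<open>T'\<close> being in \<open>N\<close> too.
\<close>

lemma onto_imp_maximal: "maximal_wrt N T"
  unfolding maximal_wrt_def
proof (intro conjI allI impI range, elim conjE)
  fix T' assume T': "is_operator T'" "T \<subseteq>\<^sub>m T'" "numerical_range T' \<subseteq> N"
  interpret ext: operator_in_range T' N
    using T' closed_N N_nonempty by unfold_locales
  have agree: "x \<in> dom T \<Longrightarrow> T x = T' x" for x using T'(2) by (simp add: map_le_def)
  have "dom T' \<subseteq> dom T"
  proof
    fix x assume x: "x \<in> dom T'"
    define y where "y = resolvent l (ext.shift l x)"
    have y: "y \<in> dom T" by (simp add: y_def resolvent_dom)
    then have "ext.shift l y = shift l y" "y \<in> dom T'"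
      using agree[OF y] y by (simp_all add: ext.shift_def shift_def domIff)
    then have "x = y"
      using x ext.inj_shift[OF l] by (auto simp: y_def shift_resolvent inj_on_def)
    then show "x \<in> dom T" using y by simp
  qed
  then show "T = T'" using agree by (metis domIff ext subsetD)
qed

text \<open>
  The equation \<open>(T - m)x = y\<close> is the fixed point equation \<open>x = (T - l)\<^sup>-\<^sup>1 (y + (m - l)x)\<close>. Its right-hand
  side is a contraction because the inverse has norm at most \<open>1 / dist(l, N)\<close>.
\<close>

lemma onto_perturb:
  assumes "cmod (m - l) < infdist l N"
  shows "onto m"
proof -
  define c where "c = cmod (m - l) / infdist l N"
  have c: "0 \<le> c" "c < 1" using assms infdist_pos[OF l] by (simp_all add: c_def)
  have "\<exists>x\<in>dom T. shift m x = y" for y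
  proof -
    define h where "h x = resolvent l (y + (m - l) *\<^sub>C x)" for x
    have "dist (h x) (h z) \<le> c * dist x z" for x z
      using norm_resolvent_diff[of "y + (m - l) *\<^sub>C x" "y + (m - l) *\<^sub>C z"]
      by (simp add: h_def dist_norm c_def norm_scaleC flip: complex_vector.scale_right_diff_distrib)
    then obtain x where x: "h x = x" using banach_fix_type[of c h] c by blast
    have "shift l x = y + (m - l) *\<^sub>C x" using x shift_resolvent unfolding h_def by metis
    then have "shift m x = y"
      by (simp add: shift_def complex_vector.scale_left_diff_distrib algebra_simps)
    then show ?thesis using x resolvent_dom unfolding h_def by metis
  qed
  then show ?thesis unfolding onto_def by (auto simp: image_def) metis
qed

end

text \<open>
  Within half the distance to \<open>N\<close> the perturbation lemma applies in both directions, so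
  surjectivity is locally constant off \<open>N\<close>.
\<close>

lemma onto_transfer:
  assumes "connected (- N)" "l \<notin> N" "m \<notin> N" "onto l"
  shows "onto m"
proof -
  have "onto a = onto b" if a: "a \<notin> N" and ab: "dist b a < infdist a N / 2" for a b
  proof -
    have "infdist a N \<le> infdist b N + dist b a"
      using infdist_triangle[of a N b] by (simp add: dist_commute)
    then have b: "dist a b < infdist b N" using ab by (simp add: dist_commute)
    then have "b \<notin> N" using infdist_zero[of b N] zero_le_dist[of a b] by force
    show ?thesis
      using onto_perturb[OF a, of b] onto_perturb[OF \<open>b \<notin> N\<close>, of a] ab b infdist_pos[OF a]
      by (auto simp: dist_norm)
  qed
  then have "eventually (\<lambda>b. onto a = onto b) (at a within - N)" if "a \<in> - N" for a
    unfolding eventually_at using that infdist_pos[of a]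
    by (intro exI[of _ "infdist a N / 2"]) auto
  from connected_local_const[OF assms(1), of l m onto] this show ?thesis
    using assms(2-4) by auto
qed

text \<open>
  The lower bound makes preimages of convergent sequences Cauchy, so for a closed operator the range
  of \<open>T - l\<close> is closed; a closed subspace with trivial orthogonal complement is the whole space.
\<close>

lemma closed_defect_imp_onto:
  assumes l: "l \<notin> N" and closed: "closed_operator T"
    and orth: "orth_complement (shift l ` dom T) \<subseteq> {0}"
  shows "onto l"
  unfolding onto_def
proof (rule closed_subspace_eq_UNIV[OF subspace_range_shift _ orth])
  show "closed (shift l ` dom T)"
    unfolding closed_sequential_limits
  proof (intro allI impI, elim conjE)
    fix Y y assume "\<forall>n. Y n \<in> shift l ` dom T" and Y: "Y \<longlonglongrightarrow> y"
    then obtain X where X: "\<And>n. X n \<in> dom T" "\<And>n. Y n = shift l (X n)"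
      unfolding image_iff by metis
    have "Cauchy X"
    proof (rule metric_CauchyI)
      fix e :: real assume "e > 0"
      then have "e * infdist l N > 0" using infdist_pos[OF l] by simp
      then obtain M where M: "\<And>m n. m \<ge> M \<Longrightarrow> n \<ge> M \<Longrightarrow> dist (Y m) (Y n) < e * infdist l N"
        using LIMSEQ_imp_Cauchy[OF Y] unfolding Cauchy_def by metis
      have "dist (X m) (X n) < e" if "m \<ge> M" "n \<ge> M" for m n
      proof -
        have "infdist l N * dist (X m) (X n) \<le> dist (Y m) (Y n)"
          using lower_bound[OF dom_diff[OF X(1) X(1)], of l m n] by (simp add: dist_norm X shift_diff)
        also have "\<dots> < infdist l N * e" using M[OF that] by (simp add: mult.commute)
        finally show ?thesis using infdist_pos[OF l] by simp
      qed
      then show "\<exists>M. \<forall>m\<ge>M. \<forall>n\<ge>M. dist (X m) (X n) < e" by blast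
    qed
    then obtain x where x: "X \<longlonglongrightarrow> x" using Cauchy_convergent_iff convergent_def by blast
    have TX: "the (T (X n)) = Y n + l *\<^sub>C X n" for n by (simp add: X(2) shift_def)
    have "(\<lambda>n. (X n, the (T (X n)))) \<longlonglongrightarrow> (x, y + l *\<^sub>C x)"
      unfolding TX by (intro tendsto_Pair tendsto_add tendsto_scaleC tendsto_const x Y)
    moreover have "(X n, the (T (X n))) \<in> Map.graph T" for n
      using X(1)[of n] by (auto simp: Map.graph_def)
    ultimately have "(x, y + l *\<^sub>C x) \<in> Map.graph T"
      using closed unfolding closed_operator_def by (rule_tac closed_sequentially) auto
    then have "x \<in> dom T" "shift l x = y" by (auto simp: Map.graph_def shift_def)
    then show "y \<in> shift l ` dom T" by blast
  qed
qed

end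

section \<open>Cones in the complex plane\<close>

text \<open>
  A sector in Cartesian terms, with \<open>M\<close> the tangent of the half-angle. The condition on the real part
  matters in the degenerate case \<open>M = 0\<close>, where the other inequality describes the whole real line.
\<close>

definition cone :: "real \<Rightarrow> real \<Rightarrow> complex set" where
  "cone g M = {z. g \<le> Re z \<and> \<bar>Im z\<bar> \<le> M * (Re z - g)}"

lemma sector_subset_cone:
  assumes "0 \<le> t" "t < pi / 2"
  shows "sector g t \<subseteq> cone g (tan t)"
proof
  fix l assume l: "l \<in> sector g t"
  define z where "z = l - of_real g"
  define a where "a = Arg z"
  have a: "\<bar>a\<bar> \<le> t" using l by (simp add: sector_def a_def z_def)
  have z: "Re z = cmod z * cos a" "Im z = cmod z * sin a"
    by (metis a_def Re_rcis rcis_cmod_Arg, metis a_def Im_rcis rcis_cmod_Arg)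
  have cos: "0 < cos a" using a assms by (intro cos_gt_zero_pi) auto
  have "\<bar>sin a\<bar> = tan \<bar>a\<bar> * cos a"
    using cos a assms sin_ge_zero[of "\<bar>a\<bar>"] by (cases "0 \<le> a") (auto simp: tan_def abs_if)
  also have "\<dots> \<le> tan t * cos a"
    using a assms cos tan_mono_le[of "\<bar>a\<bar>" t] by (intro mult_right_mono) auto
  finally have "\<bar>Im z\<bar> \<le> tan t * Re z"
    unfolding z abs_mult by (metis abs_norm_cancel mult.left_commute mult_left_mono norm_ge_zero)
  moreover have "0 \<le> Re z" using z(1) cos by simp
  ultimately show "l \<in> cone g (tan t)" by (simp add: cone_def z_def)
qed

text \<open>
  The complement of a cone is star-shaped around any point to the left of the vertex: moving away
  from such a point, one can enter the cone but not leave it.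
\<close>

lemma starlike_compl_cone:
  assumes "0 \<le> M" "z \<notin> cone g M"
  shows "closed_segment (of_real (g - 1)) z \<subseteq> - cone g M"
proof
  fix x assume "x \<in> closed_segment (of_real (g - 1)) z"
  then obtain u where u: "0 \<le> u" "u \<le> 1" "x = (1 - u) *\<^sub>R of_real (g - 1) + u *\<^sub>R z"
    by (auto simp: in_segment)
  have re: "Re x - g = u * (Re z - g) - (1 - u)" and im: "Im x = u * Im z"
    unfolding u(3) by (simp_all add: algebra_simps)
  show "x \<in> - cone g M"
  proof
    assume x: "x \<in> cone g M"
    then have 1: "0 \<le> u * (Re z - g) - (1 - u)" and 2: "u * \<bar>Im z\<bar> \<le> M * (u * (Re z - g) - (1 - u))"
      using u(1) unfolding re[symmetric] by (auto simp: cone_def im abs_mult)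
    have "u > 0" using 1 u by (cases "u = 0") auto
    moreover have "0 \<le> u * (Re z - g)" using 1 u(2) by linarith
    moreover have "u * \<bar>Im z\<bar> \<le> u * (M * (Re z - g))"
      using 2 mult_left_mono[OF _ assms(1), of "u * (Re z - g) - (1 - u)" "u * (Re z - g)"] u(2)
      by (simp add: mult.left_commute)
    ultimately have "z \<in> cone g M" by (simp add: cone_def zero_le_mult_iff)
    then show False using assms(2) by simp
  qed
qed

lemma ray_leaves_cone:
  assumes "Re d \<le> 0" "d \<noteq> 0"
  obtains t :: real where "z + t *\<^sub>R d \<notin> cone g M"
proof (cases "Re d = 0")
  case True
  then have d: "Im d \<noteq> 0" using assms by (simp add: complex_eq_iff)
  define B where "B = M * (Re z - g)"
  define t where "t = (\<bar>B\<bar> + \<bar>Im z\<bar> + 1) / Im d"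
  have "t * Im d = \<bar>B\<bar> + \<bar>Im z\<bar> + 1" using d by (simp add: t_def)
  then have "B < Im z + t * Im d" by linarith
  then have "z + t *\<^sub>R d \<notin> cone g M" using True by (auto simp: cone_def B_def)
  then show ?thesis by (rule that)
next
  case False
  then have "Re (z + ((g - 1 - Re z) / Re d) *\<^sub>R d) = g - 1" by simp
  then have "z + ((g - 1 - Re z) / Re d) *\<^sub>R d \<notin> cone g M" by (auto simp: cone_def)
  then show ?thesis by (rule that)
qed

text \<open>
  A point \<open>l\<close> off \<open>N\<close> is separated from \<open>N\<close> by a line. The parallel to that line through \<open>l\<close> avoids \<open>N\<close>,
  and in one of its two directions the real part does not increase, so it leaves the cone there.
  Outside the cone, all points are joined to a common one.
\<close>

lemma connected_compl_convex_in_cone: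
  assumes N: "closed N" "convex N" "N \<noteq> {}" "N \<subseteq> cone g M" and M: "0 \<le> M"
  shows "connected (- N)"
proof -
  define p :: complex where "p = of_real (g - 1)"
  have "connected_component (- N) p l" if l: "l \<notin> N" for l
  proof -
    obtain a b where ab: "a \<bullet> l < b" "\<And>x. x \<in> N \<Longrightarrow> b < a \<bullet> x"
      using separating_hyperplane_closed_point[OF N(2,1) l] by blast
    have "a \<noteq> 0" using ab N(3) by force
    define d where "d = \<i> * a"
    have d: "d \<noteq> 0" "a \<bullet> d = 0" using \<open>a \<noteq> 0\<close> by (auto simp: d_def inner_complex_def)
    obtain d' where d': "d' \<noteq> 0" "a \<bullet> d' = 0" "Re d' \<le> 0"
      using d that[of d] by (cases "Re d \<le> 0") (auto intro: that[of "- d"] that[of d])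
    obtain t :: real where w: "l + t *\<^sub>R d' \<notin> cone g M" using ray_leaves_cone[OF d'(3,1)] .
    have "closed_segment l (l + t *\<^sub>R d') \<subseteq> - N"
    proof
      fix x assume "x \<in> closed_segment l (l + t *\<^sub>R d')"
      then obtain u where "x = l + (u * t) *\<^sub>R d'" by (auto simp: in_segment algebra_simps)
      then have "a \<bullet> x = a \<bullet> l" using d'(2) by (simp add: inner_add_right)
      then show "x \<in> - N" using ab by force
    qed
    then have 1: "connected_component (- N) l (l + t *\<^sub>R d')"
      by (meson connected_component_def connected_segment ends_in_segment)
    have "closed_segment p (l + t *\<^sub>R d') \<subseteq> - N"
      using starlike_compl_cone[OF M w] N(4) by (auto simp: p_def)
    then have "connected_component (- N) p (l + t *\<^sub>R d')"
      by (meson connected_component_def connected_segment ends_in_segment)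
    then show ?thesis using 1 connected_component_sym connected_component_trans by metis
  qed
  then show ?thesis
    unfolding connected_iff_connected_component
    using connected_component_sym connected_component_trans by (metis ComplD)
qed

section \<open>Operators with numerical range in a cone\<close>

locale sectorial_operator = operator_in_range +
  fixes g M :: real
  assumes M_nonneg: "0 \<le> M" and N_cone: "N \<subseteq> cone g M"
begin

text \<open>One unit to the left of the vertex, so that the coercivity constant is \<open>1\<close>.\<close>

definition base :: complex where "base = of_real (g - 1)"

lemma base_notin: "base \<notin> N"
  using N_cone by (auto simp: base_def cone_def)

sublocale sectorial_form "dom T" "shift base" "1 + M"
proof
  fix x assume x: "x \<in> dom T"
  obtain n where n: "n \<in> N" "cinner (shift base x) x = of_real ((norm x)\<^sup>2) * (n - base)"
    using form_value[OF x] by metis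
  have nc: "g \<le> Re n" "\<bar>Im n\<bar> \<le> M * (Re n - g)" using n(1) N_cone by (auto simp: cone_def)
  have re: "Re (cinner (shift base x) x) = (norm x)\<^sup>2 * (Re n - g + 1)"
    unfolding n(2) by (simp add: base_def)
  then show "(norm x)\<^sup>2 \<le> Re (cinner (shift base x) x)"
    using nc by (simp add: mult_le_cancel_left1)
  have "cmod (n - base) \<le> \<bar>Re (n - base)\<bar> + \<bar>Im (n - base)\<bar>" by (rule cmod_le)
  also have "\<dots> \<le> (1 + M) * (Re n - g + 1)"
    using nc M_nonneg by (simp add: base_def algebra_simps)
  finally have "(norm x)\<^sup>2 * cmod (n - base) \<le> (norm x)\<^sup>2 * ((1 + M) * (Re n - g + 1))"
    by (intro mult_left_mono) auto
  then show "cmod (cinner (shift base x) x) \<le> (1 + M) * Re (cinner (shift base x) x)"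
    unfolding re unfolding n(2) norm_mult norm_of_real by (simp add: mult.left_commute)
qed (use subspace_dom shift_add shift_scale M_nonneg in auto)

text \<open>
  A vector orthogonal to the domain has the form \<open>(T - b)x\<close>; being orthogonal to \<open>x\<close> itself, it makes
  the energy of \<open>x\<close> vanish.
\<close>

lemma onto_imp_dense:
  assumes "onto base"
  shows "densely_defined T"
  unfolding densely_defined_def dense_subspace_iff[OF subspace_dom]
proof
  fix y assume y: "y \<in> orth_complement (dom T)"
  obtain x where x: "x \<in> dom T" "y = shift base x" using assms unfolding onto_def by blast
  have "cinner (shift base x) x = 0"
    using y x cinner_commute[of y x] by (simp add: orth_complement_def)
  then have "x = 0" using coercive[OF x(1)] by simp
  then show "y \<in> {0}" using x(2) A_zero by simp
qed

text \<open>
  A one-dimensional Friedrichs extension. For a given \<open>f\<close>, take the weak solution \<open>u\<close> of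
  \<open>(T - b)u = f\<close> and adjoin the pair \<open>(u, f)\<close> to the graph of \<open>T - b\<close>. The result is treated
  as a linear relation \<open>G\<close>, since \<open>u\<close> may already belong to the domain of \<open>T\<close>. Each form value of \<open>G\<close> is
  a limit of form values of \<open>T - b\<close> along vectors that converge in norm. Hence \<open>G\<close> is accretive,
  so single-valued by density, and adding \<open>b\<close> back gives an operator with numerical range in the
  closed set \<open>N\<close>. By maximality this operator is \<open>T\<close>.
\<close>

lemma maximal_dense_imp_onto:
  assumes max: "maximal_wrt N T" and dense: "densely_defined T"
  shows "onto base"
proof -
  have "f \<in> shift base ` dom T" for f
  proof -
    obtain X u where X: "\<And>n. X n \<in> dom T" "X \<longlonglongrightarrow> u"
      "\<And>w. w \<in> dom T \<Longrightarrow> (\<lambda>n. cinner (shift base (X n)) w) \<longlonglongrightarrow> cinner f w"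
      "(\<lambda>n. cinner (shift base (X n)) (X n)) \<longlonglongrightarrow> cinner f u"
      using weak_solution[of f] by metis
    define G where "G = {(x + c *\<^sub>C u, shift base x + c *\<^sub>C f) | x c. x \<in> dom T}"
    have GI: "(x + c *\<^sub>C u, shift base x + c *\<^sub>C f) \<in> G" if "x \<in> dom T" for x c
      using that by (auto simp: G_def)
    have extends: "(x, shift base x) \<in> G" if "x \<in> dom T" for x using GI[OF that, of 0] by simp
    have uf: "(u, f) \<in> G" using GI[OF D_zero, of 1] by (simp add: A_zero scaleC_one)
    have G_add: "(z + z', q + q') \<in> G" if "(z, q) \<in> G" "(z', q') \<in> G" for z q z' q'
    proof -
      obtain x c x' c' where *: "x \<in> dom T" "x' \<in> dom T"
        "z = x + c *\<^sub>C u" "q = shift base x + c *\<^sub>C f"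
        "z' = x' + c' *\<^sub>C u" "q' = shift base x' + c' *\<^sub>C f"
        using \<open>(z, q) \<in> G\<close> \<open>(z', q') \<in> G\<close> unfolding G_def by blast
      show ?thesis
        using GI[OF D_add[OF *(1,2)], of "c + c'"] *
        by (simp add: shift_add scaleC_add_left add_ac)
    qed
    have G_scale: "(d *\<^sub>C z, d *\<^sub>C q) \<in> G" if "(z, q) \<in> G" for d z q
    proof -
      obtain x c where *: "x \<in> dom T" "z = x + c *\<^sub>C u" "q = shift base x + c *\<^sub>C f"
        using \<open>(z, q) \<in> G\<close> unfolding G_def by blast
      show ?thesis
        using GI[OF D_scale[OF *(1)], of d "d * c"] *
        by (simp add: shift_scale scaleC_add_right scaleC_scaleC)
    qed
    have approx: "\<exists>Z. (\<forall>n. Z n \<in> dom T) \<and> Z \<longlonglongrightarrow> z \<and>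
        (\<lambda>n. cinner (shift base (Z n)) (Z n)) \<longlonglongrightarrow> cinner q z" if "(z, q) \<in> G" for z q
    proof -
      obtain x c where *: "x \<in> dom T" "z = x + c *\<^sub>C u" "q = shift base x + c *\<^sub>C f"
        using \<open>(z, q) \<in> G\<close> unfolding G_def by blast
      let ?Z = "\<lambda>n. x + c *\<^sub>C X n"
      have "?Z \<longlonglongrightarrow> z" unfolding *(2) by (intro tendsto_add tendsto_scaleC tendsto_const X(2))
      moreover have "(\<lambda>n. cinner (shift base (?Z n)) (?Z n)) \<longlonglongrightarrow>
        cinner (shift base x) x + cnj c * cinner (shift base x) u + c * cinner f x
          + c * cnj c * cinner f u" (is "_ \<longlonglongrightarrow> ?L")
        unfolding form_expand[OF *(1) X(1)]
        by (intro tendsto_add tendsto_mult tendsto_const X(3,4) *(1) tendsto_cinner X(2))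
      moreover have "?L = cinner q z"
        unfolding *(2,3)
        by (simp add: cinner_add_left cinner_add_right cinner_scaleC_left cinner_scaleC_right
            algebra_simps)
      moreover have "\<forall>n. ?Z n \<in> dom T" using *(1) X(1) D_add D_scale by blast
      ultimately show ?thesis by (intro exI[of _ ?Z]) simp
    qed
    have accretive: "0 \<le> Re (cinner q z)" if zq: "(z, q) \<in> G" for z q
    proof -
      obtain Z where Z: "\<forall>n. Z n \<in> dom T" "(\<lambda>n. cinner (shift base (Z n)) (Z n)) \<longlonglongrightarrow> cinner q z"
        using approx[OF zq] by blast
      have "0 \<le> Re (cinner (shift base (Z n)) (Z n))" for n
        using energy_nonneg Z(1) by (simp add: energy_def)
      then show ?thesis using tendsto_Re[OF Z(2)] by (intro LIMSEQ_le_const) auto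
    qed
    have "dom T \<subseteq> Domain G" using extends by blast
    then have "orth_complement (Domain G) \<subseteq> orth_complement (dom T)"
      by (auto simp: orth_complement_def)
    also have "\<dots> \<subseteq> {0}"
      using dense unfolding densely_defined_def dense_subspace_iff[OF subspace_dom] .
    finally have unique: "q = q'" if "(z, q) \<in> G" "(z, q') \<in> G" for z q q'
      using accretive_relation_single_valued[of G, OF G_add G_scale accretive] that by blast
    define T' where
      "T' z = (if z \<in> Domain G then Some ((THE q. (z, q) \<in> G) + base *\<^sub>C z) else None)" for z
    have T'_eq: "T' z = Some (q + base *\<^sub>C z)" if zq: "(z, q) \<in> G" for z q
    proof -
      have "(THE q. (z, q) \<in> G) = q" using zq unique by blast
      then show ?thesis using zq by (auto simp: T'_def)
    qed
    have dom_T': "dom T' = Domain G" by (auto simp: T'_def split: if_splits)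
    have "is_operator T'"
      unfolding is_operator_def
    proof (intro conjI ballI allI)
      show "complex_vector.subspace (dom T')"
        unfolding complex_vector.subspace_def dom_T'
        using extends[OF D_zero] G_add G_scale by blast
    next
      fix x y assume "x \<in> dom T'" "y \<in> dom T'"
      then obtain q r where qr: "(x, q) \<in> G" "(y, r) \<in> G" unfolding dom_T' by blast
      show "the (T' (x + y)) = the (T' x) + the (T' y)"
        using T'_eq[OF qr(1)] T'_eq[OF qr(2)] T'_eq[OF G_add[OF qr]]
        by (simp add: scaleC_add_right)
    next
      fix c x assume "x \<in> dom T'"
      then obtain q where q: "(x, q) \<in> G" unfolding dom_T' by blast
      show "the (T' (c *\<^sub>C x)) = c *\<^sub>C the (T' x)"
        using T'_eq[OF q] T'_eq[OF G_scale[OF q]]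
        by (simp add: scaleC_add_right scaleC_scaleC mult.commute)
    qed
    moreover have "T \<subseteq>\<^sub>m T'"
      unfolding map_le_def using T'_eq[OF extends] by (auto simp: shift_def)
    moreover have "numerical_range T' \<subseteq> N"
    proof
      fix k assume "k \<in> numerical_range T'"
      then obtain z where z: "k = cinner (the (T' z)) z" "z \<in> dom T'" "norm z = 1"
        by (auto simp: numerical_range_def)
      then obtain q where q: "(z, q) \<in> G" unfolding dom_T' by blast
      have k: "k = cinner q z + base"
        using z T'_eq[OF q] by (simp add: cinner_add_left cinner_scaleC_left cinner_self)
      obtain Z where Z: "\<And>n. Z n \<in> dom T" "Z \<longlonglongrightarrow> z"
        "(\<lambda>n. cinner (shift base (Z n)) (Z n)) \<longlonglongrightarrow> cinner q z"
        using approx[OF q] by blast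
      \<comment> \<open>\<open>v\<close> approximates \<open>k\<close>: it is the value of the form of \<open>T\<close> at the normalized \<open>Z n\<close>\<close>
      have "\<exists>v\<in>N. cinner (shift base (Z n)) (Z n) = of_real ((norm (Z n))\<^sup>2) * (v - base)" for n
        using form_value[OF Z(1)[of n]] by metis
      then obtain v where v: "\<And>n. v n \<in> N"
        "\<And>n. cinner (shift base (Z n)) (Z n) = of_real ((norm (Z n))\<^sup>2) * (v n - base)" by metis
      have nZ: "(\<lambda>n. norm (Z n)) \<longlonglongrightarrow> 1" using tendsto_norm[OF Z(2)] z(3) by simp
      have "(\<lambda>n. cinner (shift base (Z n)) (Z n) / of_real ((norm (Z n))\<^sup>2) + base)
          \<longlonglongrightarrow> cinner q z / of_real (1\<^sup>2) + base"
        by (intro tendsto_add tendsto_divide tendsto_of_real tendsto_power tendsto_const nZ Z(3)) simp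
      moreover have "\<forall>\<^sub>F n in sequentially.
          cinner (shift base (Z n)) (Z n) / of_real ((norm (Z n))\<^sup>2) + base = v n"
        using order_tendstoD(1)[OF nZ, of 0] by (auto elim!: eventually_mono simp: v(2))
      ultimately have "v \<longlonglongrightarrow> k" unfolding k by (simp add: tendsto_cong)
      then show "k \<in> N" using closed_sequentially[OF closed_N] v(1) by blast
    qed
    ultimately have "T = T'" using max by (simp add: maximal_wrt_def)
    then have "T u = Some (f + base *\<^sub>C u)" using T'_eq[OF uf] by simp
    then have "u \<in> dom T" "shift base u = f" by (auto simp: shift_def)
    then show ?thesis by blast
  qed
  then show ?thesis by (auto simp: onto_def)
qed

end

section \<open>The equivalence\<close>

theorem theorem4p1:
  fixes N S :: "complex set" and T :: "'a::complex_hilbert_space \<rightharpoonup> 'a"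
  assumes "N \<noteq> {}" and "closed N" and "convex N"
    and "is_sector S" and "N \<subseteq> S"
    and "is_operator T" and "numerical_range T \<subseteq> N"
  shows "(maximal_wrt N T \<and> densely_defined T \<longleftrightarrow> (\<exists>l\<in>- N. ran (op_shift T l) = UNIV)) \<and>
         ((\<exists>l\<in>- N. ran (op_shift T l) = UNIV) \<longleftrightarrow> - N \<subseteq> resolvent_set T) \<and>
         (- N \<subseteq> resolvent_set T \<longleftrightarrow> closed_operator T \<and> (\<forall>l\<in>- N. defect_number T l = 0)) \<and>
         (maximal_wrt N T \<and> densely_defined T \<longrightarrow> closed_operator T)"
proof -
  obtain g t where t: "0 \<le> t" "t < pi / 2" "S = sector g t"
    using assms(4) unfolding is_sector_def by blast
  have tan: "0 \<le> tan t" using t tan_pos_pi2_le by simp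
  have cone: "N \<subseteq> cone g (tan t)" using sector_subset_cone[OF t(1,2)] assms(5) t(3) by blast
  interpret sectorial_operator T N g "tan t"
    using assms tan cone by unfold_locales
  have conn: "connected (- N)"
    using connected_compl_convex_in_cone[OF assms(2,3,1) cone tan] .
  have ran_iff: "ran (op_shift T l) = UNIV \<longleftrightarrow> onto l" for l
    by (simp add: ran_op_shift onto_def)
  have resolvent_iff: "l \<in> resolvent_set T \<longleftrightarrow> onto l" if "l \<notin> N" for l
  proof
    assume "l \<in> resolvent_set T"
    then have "(\<lambda>x. the (op_shift T l x)) ` dom T = UNIV"
      by (simp add: resolvent_set_def bij_betw_imp_surj_on)
    then show "onto l" by (simp add: onto_def the_op_shift cong: image_cong_simp)
  qed (rule onto_imp_resolvent_set[OF that])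
  \<comment> \<open>surjectivity at \<open>base\<close> is the pivot to which all the conditions are reduced\<close>
  have some_all: "(\<exists>l\<in>- N. onto l) \<longleftrightarrow> onto base" "(\<forall>l\<in>- N. onto l) \<longleftrightarrow> onto base"
    using onto_transfer[OF conn] base_notin by blast+
  have defect_iff: "defect_number T l = 0 \<longleftrightarrow> orth_complement (shift l ` dom T) \<subseteq> {0}" for l
    by (simp add: defect_number_def ran_op_shift cdim_eq_0_iff)
  have one: "maximal_wrt N T \<and> densely_defined T \<longleftrightarrow> onto base"
    using maximal_dense_imp_onto onto_imp_maximal[OF base_notin] onto_imp_dense by blast
  have three: "- N \<subseteq> resolvent_set T \<longleftrightarrow> onto base"
    using resolvent_iff some_all(2) by blast
  have four: "closed_operator T \<and> (\<forall>l\<in>- N. defect_number T l = 0) \<longleftrightarrow> onto base"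
  proof
    assume "closed_operator T \<and> (\<forall>l\<in>- N. defect_number T l = 0)"
    then show "onto base" using closed_defect_imp_onto base_notin defect_iff by blast
  next
    assume base: "onto base"
    have "defect_number T l = 0" if "l \<in> - N" for l
    proof -
      have "shift l ` dom T = UNIV" using some_all(2) base that by (simp add: onto_def)
      then show ?thesis
        unfolding defect_iff by (simp add: dense_subspace_iff[symmetric])
    qed
    then show "closed_operator T \<and> (\<forall>l\<in>- N. defect_number T l = 0)"
      using onto_imp_closed[OF base_notin base] by blast
  qed
  show ?thesis
    unfolding ran_iff one three four some_all(1)
    using onto_imp_closed[OF base_notin] by blast
qed

end
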